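(* Consider $n$ parallel servers, each of capacity $C$, and an online sequence of job sets $J(1),\dots,J(T)$ in which every job $j$ has weight $w(j)\in[0,\epsilon]$. Let $\mathrm{ALG}=\sum_i W(A_i)$ be the total weight assigned by PARALLELLOADBALANCE (defined in the context) and $\mathrm{OPT}$ the maximum total weight of a feasible assignment for the instance. Then $\mathrm{ALG}\ge (1-2\epsilon/C)\,\mathrm{OPT}$, i.e. PARALLELLOADBALANCE is $\frac{1}{1-2\epsilon/C}$-competitive.
   Context: Parallel servers: all servers have the same capacity $C$ and each job $j$ consumes the same quantity $w(j)$ of resources on every server. At each time step $t$ a set $J(t)$ of jobs arrives; a feasible assignment assigns, at each time step, each server at most one job and each job to at most one server, such that the total weight assigned to each server over all time is at most $C$; assignments must be made online and irrevocably. For a set of jobs $A$, $W(A)=\sum_{j\in A}w(j)$. An algorithm is $\gamma$-competitive if on every instance its total weight is at least $1/\gamma$ times the optimal feasible weight. PARALLELLOADBALANCE: initially $A_i=\emptyset$ for all servers $i$. For $t=1,\dots,T$: process the jobs $j\in J(t)$ in non-increasing order of weight; for each such job, let $i$ be a server with the highest remaining capacity $C-W(A_i)$ among servers not yet assigned a job in the current time step; if $W(A_i\cup\{j\})\le C$ set $A_i\leftarrow A_i\cup\{j\}$; otherwise the algorithm terminates (no further jobs are ever assigned). *)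

theory Defs
  imports Complex_Main "HOL-Library.Disjoint_Sets"
begin

text \<open>The servers are \<open>1, \<dots>, num_servers I\<close> and the time steps \<open>1, \<dots>, horizon I\<close>; values of
  \<open>arrivals I\<close> at other times play no role.\<close>

record 'j inst =
  num_servers :: nat
  capacity :: real
  horizon :: nat
  arrivals :: "nat \<Rightarrow> 'j set"
  weight :: "'j \<Rightarrow> real"

abbreviation servers :: "'j inst \<Rightarrow> nat set" where
  "servers I \<equiv> {1..num_servers I}"

abbreviation times :: "'j inst \<Rightarrow> nat set" where
  "times I \<equiv> {1..horizon I}"

text \<open>Disjointness says that each job arrives at a single time step.\<close>

definition valid_inst :: "'j inst \<Rightarrow> bool" where
  "valid_inst I \<longleftrightarrow>
     capacity I > 0 \<and>
     (\<forall>t\<in>times I. finite (arrivals I t)) \<and>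
     disjoint_family_on (arrivals I) (times I)"

definition weights_in :: "'j inst \<Rightarrow> real set \<Rightarrow> bool" where
  "weights_in I S \<longleftrightarrow> (\<forall>t\<in>times I. \<forall>j\<in>arrivals I t. weight I j \<in> S)"

definition W :: "'j inst \<Rightarrow> 'j set \<Rightarrow> real" where
  "W I X = (\<Sum>j\<in>X. weight I j)"

text \<open>An assignment maps each server to the set of all jobs assigned to it over time.\<close>

type_synonym 'j assignment = "nat \<Rightarrow> 'j set"

definition feasible :: "'j inst \<Rightarrow> 'j assignment \<Rightarrow> bool" where
  "feasible I A \<longleftrightarrow>
     (\<forall>i\<in>servers I. A i \<subseteq> (\<Union>t\<in>times I. arrivals I t)) \<and>
     (\<forall>i\<in>servers I. \<forall>t\<in>times I. card (A i \<inter> arrivals I t) \<le> 1) \<and>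
     disjoint_family_on A (servers I) \<and>
     (\<forall>i\<in>servers I. W I (A i) \<le> capacity I)"

definition total_weight :: "'j inst \<Rightarrow> 'j assignment \<Rightarrow> real" where
  "total_weight I A = (\<Sum>i\<in>servers I. W I (A i))"

definition OPT :: "'j inst \<Rightarrow> real" where
  "OPT I = Max {total_weight I A | A. feasible I A}"

text \<open>An algorithm is a relation between instances and the assignments it may produce, so that
  arbitrary tie-breaking is covered.\<close>

definition competitive ::
  "real \<Rightarrow> ('j inst \<Rightarrow> 'j assignment \<Rightarrow> bool) \<Rightarrow> 'j inst set \<Rightarrow> bool" where
  "competitive \<gamma> alg \<I> \<longleftrightarrow>
     (\<forall>I\<in>\<I>. \<forall>A. alg I A \<longrightarrow> total_weight I A \<ge> 1 / \<gamma> * OPT I)"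

definition max_remaining :: "'j inst \<Rightarrow> 'j assignment \<Rightarrow> nat set \<Rightarrow> nat \<Rightarrow> bool" where
  "max_remaining I A U i \<longleftrightarrow>
     i \<in> U \<and> (\<forall>k\<in>U. capacity I - W I (A k) \<le> capacity I - W I (A i))"

datatype status = Continue | Terminated

text \<open>\<open>plb_step I U js A A' s\<close>: with \<open>U\<close> the servers that have not received a job in the current
  time step, processing the jobs \<open>js\<close> in this order turns \<open>A\<close> into \<open>A'\<close>. If every server has
  already received a job, the remaining jobs of the time step are dropped, and the algorithm goes
  on with the next time step.\<close>

inductive plb_step ::
  "'j inst \<Rightarrow> nat set \<Rightarrow> 'j list \<Rightarrow> 'j assignment \<Rightarrow> 'j assignment \<Rightarrow> status \<Rightarrow> bool"
  for I :: "'j inst" where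
  no_jobs: "plb_step I U [] A A Continue"
| no_server: "plb_step I {} (j # js) A A Continue"
| assign: "\<lbrakk>max_remaining I A U i; W I (A i \<union> {j}) \<le> capacity I;
    plb_step I (U - {i}) js (A(i := A i \<union> {j})) A' s\<rbrakk>
    \<Longrightarrow> plb_step I U (j # js) A A' s"
| terminate: "\<lbrakk>max_remaining I A U i; \<not> W I (A i \<union> {j}) \<le> capacity I\<rbrakk>
    \<Longrightarrow> plb_step I U (j # js) A A Terminated"

definition processing_order :: "'j inst \<Rightarrow> nat \<Rightarrow> 'j list \<Rightarrow> bool" where
  "processing_order I t js \<longleftrightarrow>
     distinct js \<and> set js = arrivals I t \<and>
     sorted_wrt (\<lambda>j k. weight I j \<ge> weight I k) js"

inductive plb_run :: "'j inst \<Rightarrow> nat \<Rightarrow> 'j assignment \<Rightarrow> 'j assignment \<Rightarrow> bool"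
  for I :: "'j inst" where
  finished: "t > horizon I \<Longrightarrow> plb_run I t A A"
| next_time: "\<lbrakk>t \<le> horizon I; processing_order I t js;
    plb_step I (servers I) js A A' Continue; plb_run I (Suc t) A' A''\<rbrakk>
    \<Longrightarrow> plb_run I t A A''"
| stopped: "\<lbrakk>t \<le> horizon I; processing_order I t js;
    plb_step I (servers I) js A A' Terminated\<rbrakk>
    \<Longrightarrow> plb_run I t A A'"

definition parallel_load_balance :: "'j inst \<Rightarrow> 'j assignment \<Rightarrow> bool" where
  "parallel_load_balance I A \<longleftrightarrow> plb_run I 1 (\<lambda>_. {}) A"

lemma plb_step_exists:
  assumes "finite U"
  shows "\<exists>A' s. plb_step I U js A A' s"
  using assms
proof (induction js arbitrary: U A)
  case Nil
  show ?case using plb_step.no_jobs by blast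
next
  case (Cons j js)
  show ?case
  proof (cases "U = {}")
    case True
    then show ?thesis using plb_step.no_server[of I j js A] by auto
  next
    case False
    define i where "i = arg_min_on (\<lambda>k. W I (A k)) U"
    have i: "max_remaining I A U i"
      using False Cons.prems arg_min_if_finite(1)[of U "\<lambda>k. W I (A k)"]
        arg_min_least[of U _ "\<lambda>k. W I (A k)"]
      by (auto simp: max_remaining_def i_def)
    have "finite (U - {i})" using Cons.prems by simp
    then show ?thesis
      using Cons.IH plb_step.assign[OF i] plb_step.terminate[OF i] by meson
  qed
qed

lemma processing_order_exists:
  assumes "finite (arrivals I t)"
  shows "\<exists>js. processing_order I t js"
proof -
  obtain xs where xs: "set xs = arrivals I t" "distinct xs"
    using assms finite_distinct_list by blast
  have "sorted (map (\<lambda>j. - weight I j) (sort_key (\<lambda>j. - weight I j) xs))"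
    by simp
  then have "processing_order I t (sort_key (\<lambda>j. - weight I j) xs)"
    using xs by (simp add: processing_order_def sorted_map)
  then show ?thesis by blast
qed

lemma parallel_load_balance_exists:
  assumes "valid_inst I"
  shows "\<exists>A. parallel_load_balance I A"
proof -
  have "\<exists>A'. plb_run I t A A'" if "t \<ge> 1" for t A
    using that
  proof (induction "Suc (horizon I) - t" arbitrary: t A)
    case 0
    then show ?case using plb_run.finished by (metis Suc_le_eq diff_is_0_eq)
  next
    case (Suc d)
    then have t: "t \<le> horizon I" by simp
    with Suc.prems assms have "finite (arrivals I t)" by (simp add: valid_inst_def)
    then obtain js where js: "processing_order I t js" using processing_order_exists by blast
    obtain A' s where st: "plb_step I (servers I) js A A' s"
      using plb_step_exists[of "servers I"] by blast
    show ?case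
    proof (cases s)
      case Continue
      moreover have "d = Suc (horizon I) - Suc t" using Suc.hyps(2) by simp
      moreover obtain A'' where "plb_run I (Suc t) A' A''"
        using Suc.hyps(1)[of "Suc t" A'] calculation(2) by auto
      ultimately show ?thesis using plb_run.next_time[OF t js] st by blast
    next
      case Terminated
      then show ?thesis using plb_run.stopped[OF t js] st by blast
    qed
  qed
  then show ?thesis by (simp add: parallel_load_balance_def)
qed

text \<open>The maximum in \<open>OPT\<close> is attained.\<close>

lemma OPT_attained:
  assumes "valid_inst I"
  shows "\<exists>A. feasible I A \<and> total_weight I A = OPT I"
    and "feasible I A \<Longrightarrow> total_weight I A \<le> OPT I"
proof -
  let ?V = "{total_weight I A | A. feasible I A}"
  let ?U = "\<Union>t\<in>times I. arrivals I t"
  have "finite ?U" using assms by (auto simp: valid_inst_def)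
  then have fin: "finite {f. \<forall>i. (i \<in> servers I \<longrightarrow> f i \<in> Pow ?U) \<and> (i \<notin> servers I \<longrightarrow> f i = {})}"
    by (intro finite_set_of_finite_funs) auto
  have "?V \<subseteq> total_weight I ` {f. \<forall>i. (i \<in> servers I \<longrightarrow> f i \<in> Pow ?U) \<and> (i \<notin> servers I \<longrightarrow> f i = {})}"
  proof
    fix v assume "v \<in> ?V"
    then obtain A where A: "v = total_weight I A" "feasible I A" by blast
    let ?f = "\<lambda>i. if i \<in> servers I then A i else {}"
    have "v = total_weight I ?f" using A(1) by (simp add: total_weight_def)
    moreover have "\<forall>i. (i \<in> servers I \<longrightarrow> ?f i \<in> Pow ?U) \<and> (i \<notin> servers I \<longrightarrow> ?f i = {})"
      using A(2) by (simp add: feasible_def)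
    ultimately show "v \<in> total_weight I ` {f. \<forall>i. (i \<in> servers I \<longrightarrow> f i \<in> Pow ?U) \<and> (i \<notin> servers I \<longrightarrow> f i = {})}"
      by blast
  qed
  then have finV: "finite ?V" using fin finite_surj by blast
  have "feasible I (\<lambda>_. {})"
    using assms by (simp add: feasible_def W_def valid_inst_def disjoint_family_on_def)
  then have "?V \<noteq> {}" by blast
  then have "OPT I \<in> ?V" unfolding OPT_def using finV Max_in by blast
  then show "\<exists>A. feasible I A \<and> total_weight I A = OPT I" by force
  show "feasible I A \<Longrightarrow> total_weight I A \<le> OPT I"
    unfolding OPT_def using finV by (intro Max_ge) auto
qed

end

theory Submission
  imports Defs
begin

text \<open>Within a time step the emptiest server receives the heaviest remaining job, so the loads of any
  two servers always differ by at most \<open>\<epsilon>\<close>. If the algorithm stops early, then some server has load at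
  least \<open>C - \<epsilon>\<close>, hence every server has load at least \<open>C - 2\<epsilon>\<close>, while the optimum is at most \<open>C\<close> per
  server. If it does not stop early, then at each time step it assigns the \<open>n\<close> heaviest jobs, which
  no feasible assignment can beat.\<close>

section \<open>Loads and total weight\<close>

definition balanced :: "'j inst \<Rightarrow> real \<Rightarrow> 'j assignment \<Rightarrow> bool" where
  "balanced I e A \<longleftrightarrow> (\<forall>i\<in>servers I. \<forall>k\<in>servers I. W I (A i) \<le> W I (A k) + e)"

lemma balancedD:
  "\<lbrakk>balanced I e A; i \<in> servers I; k \<in> servers I\<rbrakk> \<Longrightarrow> W I (A i) \<le> W I (A k) + e"
  by (simp add: balanced_def)

lemma W_add_job:
  "\<lbrakk>finite X; j \<notin> X\<rbrakk> \<Longrightarrow> W I (X \<union> {j}) = W I X + weight I j"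
  by (simp add: W_def)

lemma W_nonneg: "(\<And>j. j \<in> X \<Longrightarrow> weight I j \<ge> 0) \<Longrightarrow> W I X \<ge> 0"
  by (simp add: W_def sum_nonneg)

lemma total_weight_add_job:
  assumes "i \<in> servers I" "finite (A i)" "j \<notin> A i"
  shows "total_weight I (A(i := A i \<union> {j})) = total_weight I A + weight I j"
proof -
  have "total_weight I (A(i := A i \<union> {j}))
      = (\<Sum>k\<in>servers I. W I (A k) + (if k = i then weight I j else 0))"
    unfolding total_weight_def using assms W_add_job[of "A i" j I]
    by (intro sum.cong) auto
  also have "\<dots> = total_weight I A + weight I j"
    using assms(1) by (simp add: sum.distrib total_weight_def)
  finally show ?thesis .
qed

section \<open>A single time step\<close>

lemma plb_step_subset:
  "plb_step I U js A A' s \<Longrightarrow> A' i \<subseteq> A i \<union> set js"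
proof (induction rule: plb_step.induct)
  case (assign A U k j js A' s)
  then show ?case by (auto split: if_splits)
qed auto

text \<open>The fourth assumption is the invariant that makes the induction work: no remaining job
  can upset the balance between a server already served in this time step and one still waiting.\<close>

lemma plb_step_balanced:
  assumes "plb_step I U js A A' s"
    and "balanced I e A"
    and "U \<subseteq> servers I"
    and "\<forall>i\<in>servers I - U. \<forall>k\<in>U. \<forall>j\<in>set js. W I (A k) + weight I j \<le> W I (A i) + e"
    and "\<forall>j\<in>set js. weight I j \<in> {0..e}"
    and "sorted_wrt (\<lambda>j k. weight I j \<ge> weight I k) js"
    and "distinct js"
    and "\<forall>i. finite (A i) \<and> A i \<inter> set js = {}"
  shows "balanced I e A' \<and> (s = Terminated \<longrightarrow> (\<exists>i\<in>servers I. capacity I - e \<le> W I (A' i)))"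
  using assms
proof (induction rule: plb_step.induct)
  case (no_jobs U A)
  then show ?case by simp
next
  case (no_server j js A)
  then show ?case by simp
next
  case (terminate A U i j js)
  then have "i \<in> servers I" by (auto simp: max_remaining_def)
  moreover have "W I (A i \<union> {j}) = W I (A i) + weight I j"
    using terminate.prems by (intro W_add_job) auto
  \<comment> \<open>The job that does not fit weighs at most \<open>e\<close>.\<close>
  ultimately have "capacity I - e \<le> W I (A i)"
    using terminate by auto
  then show ?case using terminate.prems(1) \<open>i \<in> servers I\<close> by blast
next
  case (assign A U i j js A' s)
  let ?A = "A(i := A i \<union> {j})"
  have iU: "i \<in> U" and min: "\<And>k. k \<in> U \<Longrightarrow> W I (A i) \<le> W I (A k)"
    using assign.hyps(1) by (auto simp: max_remaining_def)
  then have iS: "i \<in> servers I" using assign.prems(2) by blast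
  have load: "W I (?A k) = W I (A k) + (if k = i then weight I j else 0)" for k
    using W_add_job[of "A i" j I] assign.prems(7) by auto
  have wj: "0 \<le> weight I j" "weight I j \<le> e" using assign.prems(4) by auto
  have le_j: "weight I l \<le> weight I j" if "l \<in> set js" for l
    using assign.prems(5) that by simp
  have bal: "balanced I e ?A"
    unfolding balanced_def load
  proof (intro ballI)
    fix k l assume kl: "k \<in> servers I" "l \<in> servers I"
    \<comment> \<open>Only the load of \<open>i\<close> grew, so \<open>k = i\<close> is the
      critical case. Against a waiting server \<open>l\<close>, \<open>i\<close> was lightest and
      gains at most \<open>e\<close>; against a server already served, the invariant applied to
      \<open>j\<close> is exactly the claim.\<close>
    consider "k = i" "l = i" | "k = i" "l \<noteq> i" "l \<in> U" | "k = i" "l \<noteq> i" "l \<notin> U" | "k \<noteq> i"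
      by blast
    then show "W I (A k) + (if k = i then weight I j else 0)
        \<le> W I (A l) + (if l = i then weight I j else 0) + e"
    proof cases
      case 1
      then show ?thesis using wj by simp
    next
      case 2
      then show ?thesis using wj min[of l] by simp
    next
      case 3
      then show ?thesis using assign.prems(3) iU kl by auto
    next
      case 4
      then show ?thesis using balancedD[OF assign.prems(1) kl] wj by auto
    qed
  qed
  have inv: "\<forall>l\<in>servers I - (U - {i}). \<forall>k\<in>U - {i}. \<forall>m\<in>set js.
      W I (?A k) + weight I m \<le> W I (?A l) + e"
  proof (intro ballI)
    fix l k m
    assume l: "l \<in> servers I - (U - {i})" and k: "k \<in> U - {i}" and m: "m \<in> set js"
    show "W I (?A k) + weight I m \<le> W I (?A l) + e"
    proof (cases "l = i")
      case True
      \<comment> \<open>Server \<open>i\<close> has just become a served one. The old balance bounds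
        \<open>W I (A k)\<close>, and the sorted order gives
        \<open>weight I m \<le> weight I j\<close>, the amount that \<open>i\<close> gained.\<close>
      have "k \<in> servers I" using k assign.prems(2) by blast
      then have "W I (A k) \<le> W I (A i) + e" using balancedD[OF assign.prems(1)] iS by blast
      then show ?thesis unfolding load using True k le_j[OF m] by simp
    next
      case False
      then show ?thesis unfolding load using l k m assign.prems(3) by simp
    qed
  qed
  show ?case
    using assign.prems by (intro assign.IH[OF bal _ inv]) auto
qed

text \<open>An exchange argument: \<open>X\<close> is any competing choice of at most one job per
  waiting server. The first job \<open>j\<close> is a heaviest one, so it can be traded for some
  element of \<open>X\<close>, and the induction handles the rest of \<open>X\<close> with one
  server fewer. The result \<open>Continue\<close> rules out that a job was refused for lack of
  capacity.\<close>

lemma plb_step_optimal: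
  assumes "plb_step I U js A A' s"
    and "s = Continue"
    and "U \<subseteq> servers I"
    and "\<forall>j\<in>set js. weight I j \<ge> 0"
    and "sorted_wrt (\<lambda>j k. weight I j \<ge> weight I k) js"
    and "distinct js"
    and "\<forall>i. finite (A i) \<and> A i \<inter> set js = {}"
    and "X \<subseteq> set js" and "card X \<le> card U"
  shows "total_weight I A + W I X \<le> total_weight I A'"
  using assms
proof (induction arbitrary: X rule: plb_step.induct)
  case (no_jobs U A)
  then show ?case by (simp add: W_def)
next
  case (no_server j js A)
  then have "X = {}"
    using finite_subset[of X "set (j # js)"] by simp
  then show ?case by (simp add: W_def)
next
  case (terminate A U i j js)
  then show ?case by simp
next
  case (assign A U i j js A' s)
  let ?A = "A(i := A i \<union> {j})"
  have iU: "i \<in> U" using assign.hyps(1) by (simp add: max_remaining_def)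
  have fX: "finite X" using assign.prems(7) finite_subset by blast
  have fU: "finite U" using assign.prems(2) finite_subset by blast
  have total: "total_weight I ?A = total_weight I A + weight I j"
    using iU assign.prems by (intro total_weight_add_job) auto
  have rec: "total_weight I ?A + W I Y \<le> total_weight I A'"
    if "Y \<subseteq> set js" "card Y \<le> card U - 1" for Y
    using assign.prems that iU fU by (intro assign.IH) auto
  have wj: "weight I l \<le> weight I j" if "l \<in> set (j # js)" for l
    using assign.prems(4) that by auto
  show ?case
  proof (cases "X = {}")
    case True
    then show ?thesis using rec[of "{}"] total assign.prems(3) by (simp add: W_def)
  next
    case False
    \<comment> \<open>The element traded for \<open>j\<close> is \<open>j\<close> itself whenever it
      lies in \<open>X\<close>, so that the rest of \<open>X\<close> consists of jobs from
      \<open>js\<close>.\<close>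
    then obtain x where x: "x \<in> X" "j \<in> X \<Longrightarrow> x = j" by blast
    have "X - {x} \<subseteq> set js" using x assign.prems(7) by auto
    moreover have "card (X - {x}) \<le> card U - 1" using x fX assign.prems(8) by simp
    ultimately have "total_weight I ?A + W I (X - {x}) \<le> total_weight I A'" by (rule rec)
    moreover have "W I X = weight I x + W I (X - {x})"
      using x fX by (simp add: W_def sum.remove)
    moreover have "weight I x \<le> weight I j" using x assign.prems(7) wj by blast
    ultimately show ?thesis using total by simp
  qed
qed

section \<open>The whole run\<close>

text \<open>Collects what the two lemmas on a single time step require of its jobs. No server holds
  any of them yet, because arrivals at different times are disjoint.\<close>

lemma time_stepD:
  assumes "valid_inst I" and "weights_in I {0..e}"
    and "t \<in> times I" and "processing_order I t js"
    and "\<forall>i. A i \<subseteq> (\<Union>s\<in>{1..<t}. arrivals I s)"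
  shows "set js = arrivals I t"
    and "\<forall>j\<in>set js. weight I j \<in> {0..e}"
    and "sorted_wrt (\<lambda>j k. weight I j \<ge> weight I k) js"
    and "distinct js"
    and "\<forall>i. finite (A i) \<and> A i \<inter> set js = {}"
proof -
  show js: "set js = arrivals I t" "distinct js"
    "sorted_wrt (\<lambda>j k. weight I j \<ge> weight I k) js"
    using assms(4) by (auto simp: processing_order_def)
  show "\<forall>j\<in>set js. weight I j \<in> {0..e}"
    using assms(2,3) js(1) by (simp add: weights_in_def)
  have "arrivals I s \<inter> arrivals I t = {}" if "s \<in> {1..<t}" for s
    using assms(1,3) that by (auto simp: valid_inst_def disjoint_family_on_def)
  moreover have "finite (\<Union>s\<in>{1..<t}. arrivals I s)"
    using assms(1,3) by (auto simp: valid_inst_def)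
  ultimately show "\<forall>i. finite (A i) \<and> A i \<inter> set js = {}"
    using assms(5) js(1) by (meson finite_subset) blast
qed

text \<open>The first alternative arises from early termination, the second from a run that reaches
  the horizon. \<open>X s\<close> stands for the jobs that a competing assignment places at time
  \<open>s\<close>. The start time is arbitrary for the sake of the induction, with \<open>A\<close>
  holding only jobs from before \<open>t\<close>.\<close>

lemma plb_run_outcome:
  assumes "plb_run I t A A'"
    and "t \<ge> 1"
    and "valid_inst I" and "weights_in I {0..e}"
    and "balanced I e A"
    and "\<forall>i. A i \<subseteq> (\<Union>s\<in>{1..<t}. arrivals I s)"
    and "\<forall>s\<in>times I. X s \<subseteq> arrivals I s \<and> card (X s) \<le> num_servers I"
  shows "(\<forall>i\<in>servers I. capacity I - 2 * e \<le> W I (A' i)) \<or>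
    total_weight I A + (\<Sum>s=t..horizon I. W I (X s)) \<le> total_weight I A'"
  using assms
proof (induction rule: plb_run.induct)
  case (finished t A)
  then show ?case by simp
next
  case (next_time t js A A' A'')
  have t: "t \<in> times I" using next_time by simp
  note js = time_stepD[OF next_time.prems(2,3) t next_time.hyps(2) next_time.prems(5)]
  \<comment> \<open>Initially every server is waiting, so the condition on servers already served is
    vacuous.\<close>
  have "balanced I e A'"
    using plb_step_balanced[OF next_time.hyps(3) next_time.prems(4) _ _ js(2-5)] by simp
  moreover have "\<forall>i. A' i \<subseteq> (\<Union>s\<in>{1..<Suc t}. arrivals I s)"
    using plb_step_subset[OF next_time.hyps(3)] next_time.prems(1,5) js(1)
    by (fastforce simp: atLeastLessThanSuc)
  ultimately have "(\<forall>i\<in>servers I. capacity I - 2 * e \<le> W I (A'' i)) \<or>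
      total_weight I A' + (\<Sum>s=Suc t..horizon I. W I (X s)) \<le> total_weight I A''"
    using next_time.prems by (intro next_time.IH) auto
  moreover have "total_weight I A + W I (X t) \<le> total_weight I A'"
    using next_time.prems(6) t js
    by (intro plb_step_optimal[OF next_time.hyps(3)]) auto
  moreover have "(\<Sum>s=t..horizon I. W I (X s))
      = W I (X t) + (\<Sum>s=Suc t..horizon I. W I (X s))"
    using next_time.hyps(1) by (rule sum.atLeast_Suc_atMost)
  ultimately show ?case by auto
next
  case (stopped t js A A')
  have t: "t \<in> times I" using stopped by simp
  note js = time_stepD[OF stopped.prems(2,3) t stopped.hyps(2) stopped.prems(5)]
  have bal: "balanced I e A'" and "\<exists>i\<in>servers I. capacity I - e \<le> W I (A' i)"
    using plb_step_balanced[OF stopped.hyps(3) stopped.prems(4) _ _ js(2-5)] by simp_all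
  then obtain i where i: "i \<in> servers I" "capacity I - e \<le> W I (A' i)" by blast
  have "capacity I - 2 * e \<le> W I (A' k)" if "k \<in> servers I" for k
    using balancedD[OF bal i(1) that] i(2) by simp
  then show ?case by blast
qed

section \<open>The optimum split by time, and signs of totals\<close>

text \<open>Brings the optimum into the form that can be compared with the algorithm one time step
  at a time. Disjoint arrivals justify splitting each server's load by time, disjoint servers the
  merging within a time step.\<close>

lemma feasible_total_weight_by_time:
  assumes "valid_inst I" and "feasible I B"
  shows "total_weight I B = (\<Sum>t\<in>times I. W I (\<Union>i\<in>servers I. B i \<inter> arrivals I t))"
proof -
  have fin: "finite (B i \<inter> arrivals I t)" if "t \<in> times I" for i t
    using assms(1) that by (simp add: valid_inst_def)
  have disj: "B i \<inter> B k = {}" if "i \<in> servers I" "k \<in> servers I" "i \<noteq> k" for i k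
    using assms(2) that unfolding feasible_def by (meson disjoint_family_onD)
  have "W I (B i) = (\<Sum>t\<in>times I. W I (B i \<inter> arrivals I t))" if i: "i \<in> servers I" for i
  proof -
    have "B i = (\<Union>t\<in>times I. B i \<inter> arrivals I t)"
      using assms(2) i by (auto simp: feasible_def)
    then have "W I (B i) = W I (\<Union>t\<in>times I. B i \<inter> arrivals I t)" by simp
    also have "\<dots> = (\<Sum>t\<in>times I. W I (B i \<inter> arrivals I t))"
      unfolding W_def using fin assms(1)
      by (intro sum.UNION_disjoint) (auto simp: valid_inst_def disjoint_family_on_def)
    finally show ?thesis .
  qed
  then have "total_weight I B = (\<Sum>i\<in>servers I. \<Sum>t\<in>times I. W I (B i \<inter> arrivals I t))"
    by (simp add: total_weight_def)
  also have "\<dots> = (\<Sum>t\<in>times I. \<Sum>i\<in>servers I. W I (B i \<inter> arrivals I t))"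
    by (rule sum.swap)
  also have "\<dots> = (\<Sum>t\<in>times I. W I (\<Union>i\<in>servers I. B i \<inter> arrivals I t))"
    unfolding W_def using fin disj
    by (intro sum.cong refl sum.UNION_disjoint[symmetric]) blast+
  finally show ?thesis .
qed

text \<open>Serves to show that the algorithm's total is nonnegative: \<open>weights_in\<close>
  speaks only of arriving jobs.\<close>

lemma plb_run_subset:
  assumes "plb_run I t A A'" and "t \<ge> 1"
  shows "A' i \<subseteq> A i \<union> (\<Union>s\<in>times I. arrivals I s)"
  using assms
proof (induction rule: plb_run.induct)
  case (finished t A)
  then show ?case by simp
next
  case (next_time t js A A' A'')
  have "A' i \<subseteq> A i \<union> arrivals I t"
    using plb_step_subset[OF next_time.hyps(3), of i] next_time.hyps(2)
    by (simp add: processing_order_def)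
  moreover have "t \<in> times I" using next_time by simp
  moreover have "A'' i \<subseteq> A' i \<union> (\<Union>s\<in>times I. arrivals I s)"
    by (rule next_time.IH) simp
  ultimately show ?case by blast
next
  case (stopped t js A A')
  have "A' i \<subseteq> A i \<union> arrivals I t"
    using plb_step_subset[OF stopped.hyps(3), of i] stopped.hyps(2)
    by (simp add: processing_order_def)
  moreover have "t \<in> times I" using stopped by simp
  ultimately show ?case by blast
qed

lemma total_weight_nonneg:
  assumes "weights_in I {0..e}"
    and "\<And>i. i \<in> servers I \<Longrightarrow> A i \<subseteq> (\<Union>t\<in>times I. arrivals I t)"
  shows "total_weight I A \<ge> 0"
  unfolding total_weight_def
proof (intro sum_nonneg W_nonneg)
  fix i j assume "i \<in> servers I" "j \<in> A i"
  then obtain t where "t \<in> times I" "j \<in> arrivals I t"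
    using assms(2) by blast
  then show "weight I j \<ge> 0" using assms(1) by (auto simp: weights_in_def)
qed

section \<open>The competitive ratio\<close>

lemma parallel_load_balance_bound:
  assumes "valid_inst I"
    and "weights_in I {0..e}"
    and "parallel_load_balance I A"
  shows "total_weight I A \<ge> (1 - 2 * e / capacity I) * OPT I"
proof -
  let ?c = "1 - 2 * e / capacity I"
  have C: "capacity I > 0" using assms(1) by (simp add: valid_inst_def)
  obtain B where B: "feasible I B" "total_weight I B = OPT I"
    using OPT_attained(1)[OF assms(1)] by blast
  have alg_nonneg: "total_weight I A \<ge> 0"
    using assms(3) plb_run_subset[of I 1 "\<lambda>_. {}" A]
    by (intro total_weight_nonneg[OF assms(2)]) (simp add: parallel_load_balance_def)
  have opt_nonneg: "OPT I \<ge> 0"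
    using B total_weight_nonneg[OF assms(2), of B] by (simp add: feasible_def)
  have opt_le: "OPT I \<le> num_servers I * capacity I"
    using B(1) sum_bounded_above[of "servers I" "\<lambda>i. W I (B i)" "capacity I"]
    unfolding B(2)[symmetric] total_weight_def by (simp add: feasible_def)
  \<comment> \<open>The jobs that the optimal assignment \<open>B\<close> places at time
    \<open>t\<close>, used as the competing sets in \<open>plb_run_outcome\<close>.\<close>
  let ?X = "\<lambda>t. \<Union>i\<in>servers I. B i \<inter> arrivals I t"
  have opt_eq: "OPT I = (\<Sum>t\<in>times I. W I (?X t))"
    using feasible_total_weight_by_time[OF assms(1) B(1)] B(2) by simp
  have card: "card (?X t) \<le> num_servers I" if "t \<in> times I" for t
  proof -
    have "card (?X t) \<le> (\<Sum>i\<in>servers I. card (B i \<inter> arrivals I t))"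
      by (intro card_UN_le) simp
    also have "\<dots> \<le> (\<Sum>i\<in>servers I. 1)"
      using B(1) that by (intro sum_mono) (simp add: feasible_def)
    finally show ?thesis by simp
  qed
  show ?thesis
  \<comment> \<open>The nonpositive case absorbs large \<open>e\<close> and a zero optimum; the
    other one provides \<open>?c > 0\<close> for the monotonicity step below.\<close>
  proof (cases "?c * OPT I \<le> 0")
    case True
    then show ?thesis using alg_nonneg by simp
  next
    case False
    with opt_nonneg have c: "?c > 0" and "OPT I \<noteq> 0"
      by (auto simp: not_le zero_less_mult_iff)
    \<comment> \<open>The sign of \<open>e\<close> is not assumed: it follows once some job has its
      weight in \<open>{0..e}\<close>. It is needed for the empty assignment to be balanced and for
      \<open>?c \<le> 1\<close>.\<close>
    have "\<exists>t\<in>times I. arrivals I t \<noteq> {}"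
    proof (rule ccontr)
      assume "\<not> ?thesis"
      then have "OPT I = 0" unfolding opt_eq by (simp add: W_def)
      with \<open>OPT I \<noteq> 0\<close> show False ..
    qed
    then have e: "e \<ge> 0" using assms(2) by (force simp: weights_in_def)
    have "(\<forall>i\<in>servers I. capacity I - 2 * e \<le> W I (A i)) \<or>
        total_weight I (\<lambda>_. {}) + (\<Sum>t\<in>times I. W I (?X t)) \<le> total_weight I A"
      using assms e card unfolding parallel_load_balance_def
      by (intro plb_run_outcome[where e = e]) (auto simp: balanced_def)
    moreover have "total_weight I (\<lambda>_. {}) = 0" by (simp add: total_weight_def W_def)
    ultimately consider
      "\<forall>i\<in>servers I. capacity I - 2 * e \<le> W I (A i)" | "OPT I \<le> total_weight I A"
      using opt_eq by auto
    then show ?thesis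
    proof cases
      case 1
      have "?c * OPT I \<le> ?c * (num_servers I * capacity I)"
        using opt_le c by (intro mult_left_mono) auto
      also have "\<dots> = num_servers I * (capacity I - 2 * e)"
        using C by (simp add: field_simps)
      also have "\<dots> \<le> total_weight I A"
        using 1 sum_bounded_below[of "servers I" "capacity I - 2 * e" "\<lambda>i. W I (A i)"]
        by (simp add: total_weight_def)
      finally show ?thesis .
    next
      case 2
      have "?c * OPT I \<le> 1 * OPT I"
        using e C opt_nonneg by (intro mult_right_mono) auto
      then show ?thesis using 2 by simp
    qed
  qed
qed

theorem theorem3:
  fixes I :: "'j inst" and A :: "'j assignment" and \<epsilon> :: real
  assumes "valid_inst I"
    and "weights_in I {0..\<epsilon>}"
    and "parallel_load_balance I A"
  shows "total_weight I A \<ge> (1 - 2 * \<epsilon> / capacity I) * OPT I \<and>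
    competitive (1 / (1 - 2 * \<epsilon> / capacity I))
      (parallel_load_balance :: 'j inst \<Rightarrow> 'j assignment \<Rightarrow> bool)
      {I'. valid_inst I' \<and> capacity I' = capacity I \<and> weights_in I' {0..\<epsilon>}}"
proof
  show "total_weight I A \<ge> (1 - 2 * \<epsilon> / capacity I) * OPT I"
    using assms by (rule parallel_load_balance_bound)
next
  have "total_weight I' A' \<ge> (1 - 2 * \<epsilon> / capacity I) * OPT I'"
    if "valid_inst I'" "capacity I' = capacity I" "weights_in I' {0..\<epsilon>}"
      "parallel_load_balance I' A'" for I' :: "'j inst" and A'
    using parallel_load_balance_bound[OF that(1,3,4)] that(2) by simp
  then show "competitive (1 / (1 - 2 * \<epsilon> / capacity I))
      (parallel_load_balance :: 'j inst \<Rightarrow> 'j assignment \<Rightarrow> bool)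
      {I'. valid_inst I' \<and> capacity I' = capacity I \<and> weights_in I' {0..\<epsilon>}}"
    \<comment> \<open>The identity \<open>1 / (1 / c) = c\<close> also holds for
      \<open>c = 0\<close>, since division by zero yields 0.\<close>
    by (simp add: competitive_def)
qed

end
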